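(* For each integer $n\ge 1$ let $O_n$ denote the set of odd integers $k$ with $2^n<k<2^{n+1}$, and let $T_n$ denote the set of integers $k$ with $3^{n-1}<k<3^n$ and $3\nmid k$. Then the following infinite products converge (as limits of their partial products over $n=1,\dots,N$ as $N\to\infty$) to the stated values: \begin{enumerate} \item $\displaystyle \frac{e}{4}=\prod_{n=1}^{\infty}\Bigl(\prod_{k\in O_n}\frac{k-1}{k}\Bigr)^{1/2^n}$ \quad (i.e. $(\frac{2}{3})^{1/2}(\frac{4}{5}\frac{6}{7})^{1/4}(\frac{8}{9}\frac{10}{11}\frac{12}{13}\frac{14}{15})^{1/8}\cdots$); \item $\displaystyle \sqrt{e}=2\prod_{n=1}^{\infty}\Bigl(\prod_{k\in O_n}\frac{4\lfloor k/4\rfloor+2}{k}\Bigr)^{1/2^n}$ \quad (i.e. $\frac{2}{1}(\frac{2}{3})^{1/2}(\frac{6}{5}\frac{6}{7})^{1/4}(\frac{10}{9}\frac{10}{11}\frac{14}{13}\frac{14}{15})^{1/8}\cdots$); \item $\displaystyle \frac{e^{3/2}}{2}=2\prod_{n=1}^{\infty}\Bigl(\prod_{k\in O_n}\frac{4\lfloor (k+1)/4\rfloor}{k}\Bigr)^{1/2^n}$ \quad (i.e. $\frac{2}{1}(\frac{4}{3})^{1/2}(\frac{4}{5}\frac{8}{7})^{1/4}(\frac{8}{9}\frac{12}{11}\frac{12}{13}\frac{16}{15})^{1/8}\cdots$); \item $\displaystyle \frac{e^{2/3}}{\sqrt{3}}=\prod_{n=1}^{\infty}\Bigl(\prod_{k\in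 T_n}\frac{3\lfloor (k+1)/3\rfloor}{k}\Bigr)^{1/3^n}$ \quad (i.e. $(\frac{3}{2})^{1/3}(\frac{3}{4}\frac{6}{5}\frac{6}{7}\frac{9}{8})^{1/9}(\frac{9}{10}\frac{12}{11}\frac{12}{13}\frac{15}{14}\cdots\frac{24}{25}\frac{27}{26})^{1/27}\cdots$). \end{enumerate}
   Context: $\lfloor x\rfloor$ denotes the greatest integer not exceeding $x$; $e$ is the base of the natural logarithm; all roots and fractional powers are of positive reals and are the positive real ones. *)

theory Defs
  imports Complex_Main
begin

definition odd_block :: "nat \<Rightarrow> int set" where
  "odd_block n = {k. odd k \<and> 2 ^ n < k \<and> k < 2 ^ (n + 1)}"

text \<open>The natural subtraction below is the intended one only for \<open>n \<ge> 1\<close>.\<close>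

definition nonmult3_block :: "nat \<Rightarrow> int set" where
  "nonmult3_block n = {k. 3 ^ (n - 1) < k \<and> k < 3 ^ n \<and> \<not> 3 dvd k}"

end

theory Submission imports Defs "HOL-Real_Asymp.Real_Asymp"
begin

text \<open>
  Taking logarithms, the block with weight \<open>c ^ -n\<close> (\<open>c = 2\<close> or \<open>3\<close>) becomes a combination of
  logarithms of factorials of powers of \<open>c\<close>: grouping the indices by residue modulo \<open>2\<close>, \<open>3\<close>
  or \<open>4\<close>, the multiples of \<open>c\<close> reproduce the factorials one level down. Dividing by \<open>c ^ n\<close>,
  the series telescopes in the quantities \<open>ln ((c ^ n)!) / c ^ n - n ln c\<close>, which tend to
  \<open>-1\<close> by a weak form of Stirling's formula.
\<close>

section \<open>Logarithms of factorials\<close>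

definition ln_fact :: "nat \<Rightarrow> real" where
  "ln_fact n = ln (fact n)"

lemma ln_fact_0 [simp]: "ln_fact 0 = 0"
  by (simp add: ln_fact_def)

lemma ln_fact_Suc: "ln_fact (Suc n) = ln (real n + 1) + ln_fact n"
  by (simp add: ln_fact_def ln_mult add.commute)

text \<open>The inductive step rests on the tangent bound for \<open>ln\<close> at \<open>n\<close>,
  that is \<open>n * (ln (n + 1) - ln n) \<le> 1\<close>. The case \<open>n = 0\<close> is separate
  because the tangent needs a positive base point.\<close>

lemma ln_fact_ge: "real n * ln (real n) - real n \<le> ln_fact n"
proof (induction n)
  case (Suc n)
  have "real n * (ln (real n + 1) - ln (real n)) \<le> 1"
  proof (cases "n = 0")
    case False
    then show ?thesis
      using ln_diff_le[of "real n + 1" "real n"] by (simp add: field_simps)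
  qed simp
  with Suc show ?case
    by (simp add: ln_fact_Suc algebra_simps)
qed simp

text \<open>Here the tangent is taken at \<open>n + 1\<close>, which gives
  \<open>(n + 1) * (ln (n + 1) - ln n) \<ge> 1\<close>. The surplus \<open>ln n + 1\<close> over the
  lower bound vanishes after division by \<open>n\<close>.\<close>

lemma ln_fact_le:
  assumes "n \<ge> 1"
  shows "ln_fact n \<le> real n * ln (real n) - real n + ln (real n) + 1"
  using assms
proof (induction n rule: dec_induct)
  case base
  show ?case by (simp add: ln_fact_def)
next
  case (step n)
  have "(real n + 1) * (ln (real n) - ln (real n + 1)) \<le> -1"
    using ln_diff_le[of "real n" "real n + 1"] step.hyps by (simp add: field_simps)
  with step show ?case
    by (simp add: ln_fact_Suc algebra_simps)
qed

lemma ln_fact_asymp: "(\<lambda>n. ln_fact n / real n - ln (real n)) \<longlonglongrightarrow> -1"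
proof (rule tendsto_sandwich)
  show "\<forall>\<^sub>F n in sequentially. -1 \<le> ln_fact n / real n - ln (real n)"
    using eventually_gt_at_top[of 0]
  proof eventually_elim
    case (elim n)
    then show ?case using ln_fact_ge[of n] by (simp add: field_simps)
  qed
  show "\<forall>\<^sub>F n in sequentially. ln_fact n / real n - ln (real n) \<le> -1 + (ln (real n) + 1) / real n"
    using eventually_gt_at_top[of 0]
  proof eventually_elim
    case (elim n)
    then have "ln_fact n / real n \<le> (real n * ln (real n) - real n + ln (real n) + 1) / real n"
      using ln_fact_le[of n] by (intro divide_right_mono) auto
    with elim show ?case by (simp add: add_divide_distrib diff_divide_distrib)
  qed
  show "(\<lambda>n. -1 + (ln (real n) + 1) / real n) \<longlonglongrightarrow> -1"
    by real_asymp
qed simp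

text \<open>The expression of \<open>ln_fact_asymp\<close> along the subsequence
  \<open>c ^ n\<close>, with \<open>ln (c ^ n)\<close> expanded.\<close>

definition stirling_err :: "nat \<Rightarrow> nat \<Rightarrow> real" where
  "stirling_err c n = ln_fact (c ^ n) / real c ^ n - real n * ln (real c)"

lemma stirling_err_tendsto:
  assumes "c \<ge> 2"
  shows "stirling_err c \<longlonglongrightarrow> -1"
proof -
  have "strict_mono (\<lambda>n. c ^ n)"
    using assms by (intro strict_monoI power_strict_increasing) auto
  from LIMSEQ_subseq_LIMSEQ[OF ln_fact_asymp this] show ?thesis
    using assms by (simp add: o_def stirling_err_def[abs_def] ln_realpow)
qed

lemma ln_fact_power:
  "c \<ge> 1 \<Longrightarrow> ln_fact (c ^ n) = real c ^ n * (stirling_err c n + real n * ln (real c))"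
  by (simp add: stirling_err_def)

section \<open>Sums over residue classes\<close>

lemma ln_four_sq [simp]: "ln (4::real) = 2 * ln 2"
  using ln_realpow[of "2::real" 2] by simp

lemma ln_factor_out:
  "ln (2 * real i + 2) = ln 2 + ln (real i + 1)"
  "ln (3 * real i + 3) = ln 3 + ln (real i + 1)"
  "ln (4 * real i + 4) = 2 * ln 2 + ln (real i + 1)"
  "ln (4 * real i + 2) = ln 2 + ln (2 * real i + 1)"
  using ln_mult[of 2 "real i + 1"] ln_mult[of 3 "real i + 1"] ln_mult[of 4 "real i + 1"]
    ln_mult[of 2 "2 * real i + 1"]
  by (simp_all add: algebra_simps)

text \<open>Common factors are pulled out of the new factors, so that \<open>ln (i + 1)\<close> and
  \<open>ln (2 * i + 1)\<close> can be matched with the growth of the smaller factorials.\<close>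

lemma ln_fact_steps:
  "ln_fact (2 * Suc i) = ln_fact (2 * i) + ln (2 * real i + 1) + ln 2 + ln (real i + 1)"
  "ln_fact (3 * Suc i) = ln_fact (3 * i) + ln (3 * real i + 1) + ln (3 * real i + 2)
     + ln 3 + ln (real i + 1)"
  "ln_fact (4 * Suc i) = ln_fact (4 * i) + ln (4 * real i + 1) + ln 2 + ln (2 * real i + 1)
     + ln (4 * real i + 3) + 2 * ln 2 + ln (real i + 1)"
  using ln_factor_out[of i] by (simp_all add: ln_fact_Suc numeral_eq_Suc algebra_simps)

text \<open>The odd numbers \<open>2 * j + 1\<close> are what remains of
  \<open>(2 * b)! / (2 * a)!\<close> after removing the even factors \<open>2 * (j + 1)\<close>. The
  numerators run over \<open>j\<close> instead of \<open>j + 1\<close>, whence the correction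
  \<open>ln b - ln a\<close>; \<open>1 \<le> a\<close> keeps them positive.\<close>

lemma sum_ln_mod2:
  assumes "1 \<le> a" "a \<le> b"
  shows "(\<Sum>j=a..<b. ln (2 * real j / (2 * real j + 1))) =
    2 * (real b - real a) * ln 2 + 2 * (ln_fact b - ln_fact a)
      - (ln_fact (2 * b) - ln_fact (2 * a)) - (ln (real b) - ln (real a))"
  using assms(2)
proof (induction b rule: dec_induct)
  case (step i)
  with assms(1) have "i \<ge> 1" by simp
  then have "ln (2 * real i / (2 * real i + 1)) = ln 2 + ln (real i) - ln (2 * real i + 1)"
    by (simp add: ln_div ln_mult ln_factor_out)
  with step ln_fact_steps[of i] show ?case
    by (simp add: ln_fact_Suc algebra_simps del: mult_Suc mult_Suc_right)
qed simp

text \<open>Both numerators are \<open>2 * (2 * i + 1)\<close>, so odd numbers occur at two scales: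
  squared between \<open>2 * a\<close> and \<open>2 * b\<close> above, and once between
  \<open>4 * a\<close> and \<open>4 * b\<close> below.\<close>

lemma sum_ln_mod4_middle:
  assumes "a \<le> b"
  shows "(\<Sum>i=a..<b. ln ((4 * real i + 2) / (4 * real i + 1)) + ln ((4 * real i + 2) / (4 * real i + 3))) =
    2 * (real b - real a) * ln 2 + 3 * (ln_fact (2 * b) - ln_fact (2 * a))
      - 2 * (ln_fact b - ln_fact a) - (ln_fact (4 * b) - ln_fact (4 * a))"
  using assms
proof (induction b rule: dec_induct)
  case (step i)
  have "ln ((4 * real i + 2) / (4 * real i + 1)) = ln 2 + ln (2 * real i + 1) - ln (4 * real i + 1)"
    "ln ((4 * real i + 2) / (4 * real i + 3)) = ln 2 + ln (2 * real i + 1) - ln (4 * real i + 3)"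
    by (simp_all add: ln_div ln_mult ln_factor_out)
  with step ln_fact_steps[of i] show ?case
    by (simp add: ln_fact_Suc algebra_simps del: mult_Suc mult_Suc_right)
qed simp

text \<open>The numerators contribute \<open>i\<close> and \<open>i + 1\<close>, both growing like
  \<open>b! / a!\<close>; the shifted one again costs \<open>ln b - ln a\<close>. The denominators
  are the odd numbers between \<open>4 * a\<close> and \<open>4 * b\<close>.\<close>

lemma sum_ln_mod4_outer:
  assumes "1 \<le> a" "a \<le> b"
  shows "(\<Sum>i=a..<b. ln (4 * real i / (4 * real i + 1)) + ln ((4 * real i + 4) / (4 * real i + 3))) =
    6 * (real b - real a) * ln 2 + 2 * (ln_fact b - ln_fact a) + (ln_fact (2 * b) - ln_fact (2 * a))
      - (ln_fact (4 * b) - ln_fact (4 * a)) - (ln (real b) - ln (real a))"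
  using assms(2)
proof (induction b rule: dec_induct)
  case (step i)
  with assms(1) have "i \<ge> 1" by simp
  then have "ln (4 * real i / (4 * real i + 1)) = 2 * ln 2 + ln (real i) - ln (4 * real i + 1)"
    "ln ((4 * real i + 4) / (4 * real i + 3)) = 2 * ln 2 + ln (real i + 1) - ln (4 * real i + 3)"
    by (simp_all add: ln_div ln_mult ln_factor_out)
  with step ln_fact_steps[of i] show ?case
    by (simp add: ln_fact_Suc algebra_simps del: mult_Suc mult_Suc_right)
qed simp

lemma sum_ln_mod3:
  assumes "1 \<le> a" "a \<le> b"
  shows "(\<Sum>i=a..<b. ln (3 * real i / (3 * real i + 1)) + ln ((3 * real i + 3) / (3 * real i + 2))) =
    3 * (real b - real a) * ln 3 + 3 * (ln_fact b - ln_fact a)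
      - (ln_fact (3 * b) - ln_fact (3 * a)) - (ln (real b) - ln (real a))"
  using assms(2)
proof (induction b rule: dec_induct)
  case (step i)
  with assms(1) have "i \<ge> 1" by simp
  then have "ln (3 * real i / (3 * real i + 1)) = ln 3 + ln (real i) - ln (3 * real i + 1)"
    "ln ((3 * real i + 3) / (3 * real i + 2)) = ln 3 + ln (real i + 1) - ln (3 * real i + 2)"
    by (simp_all add: ln_div ln_mult ln_factor_out)
  with step ln_fact_steps[of i] show ?case
    by (simp add: ln_fact_Suc algebra_simps del: mult_Suc mult_Suc_right)
qed simp

section \<open>The blocks\<close>

lemma finite_odd_block [simp]: "finite (odd_block n)"
  by (rule finite_subset[of _ "{2 ^ n..2 ^ (n + 1)}"]) (auto simp: odd_block_def)

lemma finite_nonmult3_block [simp]: "finite (nonmult3_block n)"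
  by (rule finite_subset[of _ "{3 ^ (n - 1)..3 ^ n}"]) (auto simp: nonmult3_block_def)

text \<open>Serves the positivity of the factors: from \<open>k = 3\<close> on, the floor of
  \<open>(k + 1) / 4\<close> is at least 1.\<close>

lemma odd_block_ge_3: "n \<ge> 1 \<Longrightarrow> k \<in> odd_block n \<Longrightarrow> k \<ge> 3"
  using power_increasing[of 1 n "2::int"] by (auto simp: odd_block_def)

lemma nonmult3_block_ge_2:
  assumes "k \<in> nonmult3_block n"
  shows "k \<ge> 2"
proof -
  have "3 ^ (n - 1) < k"
    using assms by (simp add: nonmult3_block_def)
  moreover have "(1::int) \<le> 3 ^ (n - 1)"
    by simp
  ultimately show ?thesis by linarith
qed

text \<open>The first block consists of half a pair \<open>4 * i + 1\<close>,
  \<open>4 * i + 3\<close> with \<open>i = 0\<close>, so the sums modulo 4 treat it as a base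
  case.\<close>

lemma odd_block_Suc_0: "odd_block (Suc 0) = {3}"
proof -
  have "k = 3" if "odd k" "2 < k" "k < 4" for k :: int
    using that by presburger
  then show ?thesis by (auto simp: odd_block_def)
qed

lemma nonmult3_block_Suc_0: "nonmult3_block (Suc 0) = {2}"
  by (auto simp: nonmult3_block_def)

lemma sum_odd_block:
  fixes f :: "int \<Rightarrow> real"
  shows "(\<Sum>k\<in>odd_block (Suc m). f k) = (\<Sum>j=2 ^ m..<2 ^ Suc m. f (2 * int j + 1))"
proof (rule sum.reindex_bij_witness[of _ "\<lambda>j. 2 * int j + 1" "\<lambda>k. nat (k div 2)"], goal_cases)
  case (1 k)
  then have "odd k" "k > 0"
    using odd_block_ge_3[of "Suc m" k] by (auto simp: odd_block_def)
  then show ?case by auto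
next
  case (2 k)
  then have "odd k" "2 * 2 ^ m < k" "k < 2 * 2 ^ Suc m" "k > 0"
    using odd_block_ge_3[of "Suc m" k] by (auto simp: odd_block_def)
  then have "2 ^ m \<le> k div 2" "k div 2 < 2 ^ Suc m"
    by linarith+
  then show ?case
    by (simp add: nat_less_iff le_nat_iff)
next
  case (4 j)
  then have "int (2 ^ m) \<le> int j" "int j < int (2 ^ Suc m)"
    by (simp_all only: atLeastLessThan_iff of_nat_le_iff of_nat_less_iff)
  then show ?case by (auto simp: odd_block_def)
next
  case (5 k)
  then have "odd k" "k > 0"
    using odd_block_ge_3[of "Suc m" k] by (auto simp: odd_block_def)
  then show ?case by auto
qed auto

lemma sum_pairs_interval:
  fixes f :: "nat \<Rightarrow> real"
  assumes "a \<le> b"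
  shows "(\<Sum>j=2 * a..<2 * b. f j) = (\<Sum>i=a..<b. f (2 * i) + f (2 * i + 1))"
  using assms by (induction b rule: dec_induct) simp_all

text \<open>Splitting \<open>j\<close> in \<open>k = 2 * j + 1\<close> by parity lowers the exponent
  once more, hence two successors.\<close>

lemma sum_odd_block_mod4:
  fixes f :: "int \<Rightarrow> real"
  shows "(\<Sum>k\<in>odd_block (Suc (Suc m)). f k) =
    (\<Sum>i=2 ^ m..<2 ^ Suc m. f (4 * int i + 1) + f (4 * int i + 3))"
  using sum_pairs_interval[of "2 ^ m" "2 ^ Suc m" "\<lambda>j. f (2 * int j + 1)"]
  by (simp add: sum_odd_block algebra_simps)

lemma sum_nonmult3_block:
  fixes f :: "int \<Rightarrow> real"
  shows "(\<Sum>k\<in>nonmult3_block (Suc (Suc m)). f k) =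
    (\<Sum>i=3 ^ m..<3 ^ Suc m. f (3 * int i + 1) + f (3 * int i + 2))"
proof -
  let ?I = "{3 ^ m..<3 ^ Suc m :: nat}"
  have mem: "3 * int i + r \<in> nonmult3_block (Suc (Suc m))" if "i \<in> ?I" "r = 1 \<or> r = 2" for i r
  proof -
    from that(1) have "int (3 ^ m) \<le> int i" "int i < int (3 ^ Suc m)"
      by (simp_all only: atLeastLessThan_iff of_nat_le_iff of_nat_less_iff)
    then have "3 ^ m \<le> int i" "int i < 3 ^ Suc m"
      by (simp_all only: of_nat_power of_nat_numeral)
    \<comment> \<open>Integrality gives \<open>i + 1 \<le> 3 ^ Suc m\<close>, so
      \<open>r \<le> 2\<close> stays strictly below the upper end.\<close>
    then have "3 * 3 ^ m < 3 * int i + r" "3 * int i + r < 3 * 3 ^ Suc m"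
      using that(2) by linarith+
    moreover have "\<not> 3 dvd 3 * int i + r"
      using that(2) by presburger
    ultimately show ?thesis
      by (simp add: nonmult3_block_def)
  qed
  have repr: "\<exists>i\<in>?I. k = 3 * int i + 1 \<or> k = 3 * int i + 2"
    if "k \<in> nonmult3_block (Suc (Suc m))" for k
  proof
    from that have k: "3 * 3 ^ m < k" "k < 3 * 3 ^ Suc m" "\<not> 3 dvd k"
      by (auto simp: nonmult3_block_def)
    then have "3 ^ m \<le> k div 3" "k div 3 < 3 ^ Suc m"
      by linarith+
    then show "nat (k div 3) \<in> ?I"
      by (simp add: nat_less_iff le_nat_iff)
    have "0 \<le> k div 3"
      using nonmult3_block_ge_2[OF that] by simp
    then show "k = 3 * int (nat (k div 3)) + 1 \<or> k = 3 * int (nat (k div 3)) + 2"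
      using k(3) by simp presburger
  qed
  have "nonmult3_block (Suc (Suc m)) =
      (\<lambda>i. 3 * int i + 1) ` ?I \<union> (\<lambda>i. 3 * int i + 2) ` ?I" (is "_ = ?A \<union> ?B")
    using mem repr by blast
  moreover have "?A \<inter> ?B = {}"
    by (auto, presburger)
  moreover have "sum f ?A = (\<Sum>i\<in>?I. f (3 * int i + 1))" "sum f ?B = (\<Sum>i\<in>?I. f (3 * int i + 2))"
    by (subst sum.reindex; simp add: inj_on_def)+
  ultimately show ?thesis
    by (simp add: sum.union_disjoint sum.distrib)
qed

text \<open>Positivity of the factors allows passing to logarithms; the weight \<open>w\<close> is
  left open to cover both \<open>2 ^ n\<close> and \<open>3 ^ n\<close>.\<close>

lemma prod_powr_eq_exp_sum:
  fixes f :: "int \<Rightarrow> real" and w :: "nat \<Rightarrow> real"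
  assumes "\<And>n. n \<ge> 1 \<Longrightarrow> finite (B n)" "\<And>n k. n \<ge> 1 \<Longrightarrow> k \<in> B n \<Longrightarrow> f k > 0"
  shows "(\<Prod>n=1..N. (\<Prod>k\<in>B n. f k) powr (1 / w n)) = exp (\<Sum>n=1..N. (\<Sum>k\<in>B n. ln (f k)) / w n)"
proof -
  have "(\<Prod>k\<in>B n. f k) powr (1 / w n) = exp ((\<Sum>k\<in>B n. ln (f k)) / w n)" if "n \<ge> 1" for n
  proof -
    have "(\<Prod>k\<in>B n. f k) > 0"
      using assms(2)[OF that] by (rule prod_pos)
    moreover have "ln (\<Prod>k\<in>B n. f k) = (\<Sum>k\<in>B n. ln (f k))"
      using assms[OF that] by (intro ln_prod) (metis less_irrefl)+
    ultimately show ?thesis by (simp add: powr_def)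
  qed
  then show ?thesis by (simp add: exp_sum)
qed

section \<open>Telescoping\<close>

lemma ln_fact_3: "ln_fact 3 = ln 2 + ln 3"
  by (simp add: numeral_eq_Suc ln_fact_Suc)

lemma stirling_err_small:
  "stirling_err 2 0 = 0" "stirling_err 2 (Suc 0) = - ln 2 / 2"
  "stirling_err 2 (Suc (Suc 0)) = (ln 3 - 5 * ln 2) / 4"
  "stirling_err 3 0 = 0" "stirling_err 3 (Suc 0) = (ln 2 - 2 * ln 3) / 3"
  by (simp_all add: stirling_err_def ln_fact_3 ln_fact_Suc field_simps)

text \<open>With \<open>s = stirling_err 2\<close>, the new summand is
  \<open>- 2 * s (N + 2) + 3 * s (N + 1) - s N - ln 2 / 2 ^ (N + 1)\<close>, the increment of the
  right-hand side. The constant \<open>- 2 * ln 2\<close> makes it vanish at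
  \<open>N = 0\<close>.\<close>

lemma telescope_1:
  "(\<Sum>n=1..N. (\<Sum>k\<in>odd_block n. ln ((real_of_int k - 1) / real_of_int k)) / 2 ^ n) =
    ln 2 / 2 ^ N - 2 * stirling_err 2 (Suc N) + stirling_err 2 N - 2 * ln 2"
proof (induction N)
  case (Suc N)
  \<comment> \<open>Taking \<open>b = 2 * a\<close> with \<open>a = 2 ^ N\<close> turns every
    argument into a power of two, and \<open>ln b - ln a\<close> into \<open>ln 2\<close>.\<close>
  have "(\<Sum>k\<in>odd_block (Suc N). ln ((real_of_int k - 1) / real_of_int k)) =
      2 * 2 ^ N * ln 2 + 2 * (ln_fact (2 ^ Suc N) - ln_fact (2 ^ N))
      - (ln_fact (2 ^ Suc (Suc N)) - ln_fact (2 ^ Suc N)) - ln 2"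
    using sum_ln_mod2[of "2 ^ N" "2 ^ Suc N"]
    by (simp add: sum_odd_block ln_realpow ln_mult algebra_simps)
  \<comment> \<open>Withholding \<open>power_Suc\<close> keeps the arguments in the shape
    \<open>ln_fact_power\<close> expects. After that rewriting the multiples of
    \<open>N * ln 2\<close> cancel.\<close>
  then show ?case
    using Suc by (simp add: ln_fact_power del: power_Suc) (simp add: field_simps)
qed (simp add: stirling_err_small)

text \<open>Three levels of factorials enter each block, so the telescoped form carries three
  consecutive errors. The range ends at \<open>Suc N\<close> because the pairing modulo 4 starts
  with the second block.\<close>

lemma telescope_2:
  "(\<Sum>n=1..Suc N. (\<Sum>k\<in>odd_block n.
      ln ((4 * real_of_int \<lfloor>real_of_int k / 4\<rfloor> + 2) / real_of_int k)) / 2 ^ n) =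
    - 2 * stirling_err 2 (Suc (Suc N)) + 2 * stirling_err 2 (Suc N) - stirling_err 2 N / 2 - ln 2"
proof (induction N)
  case 0
  have "\<lfloor>3 / 4 :: real\<rfloor> = 0" by (simp add: floor_eq_iff)
  then show ?case
    by (simp add: odd_block_Suc_0 stirling_err_small ln_div field_simps)
next
  case (Suc N)
  have fl: "\<lfloor>(4 * real i + 1) / 4\<rfloor> = int i" "\<lfloor>(4 * real i + 3) / 4\<rfloor> = int i" for i
    by (simp_all add: floor_eq_iff field_simps)
  have "(\<Sum>k\<in>odd_block (Suc (Suc N)). ln ((4 * real_of_int \<lfloor>real_of_int k / 4\<rfloor> + 2) / real_of_int k)) =
      2 * 2 ^ N * ln 2 + 3 * (ln_fact (2 ^ Suc (Suc N)) - ln_fact (2 ^ Suc N))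
      - 2 * (ln_fact (2 ^ Suc N) - ln_fact (2 ^ N))
      - (ln_fact (2 ^ Suc (Suc (Suc N))) - ln_fact (2 ^ Suc (Suc N)))"
    using sum_ln_mod4_middle[of "2 ^ N" "2 ^ Suc N"]
    by (simp add: sum_odd_block_mod4 fl)
  then show ?case
    using Suc by (simp add: ln_fact_power del: power_Suc) (simp add: field_simps)
qed

lemma telescope_3:
  "(\<Sum>n=1..Suc N. (\<Sum>k\<in>odd_block n.
      ln (4 * real_of_int \<lfloor>(real_of_int k + 1) / 4\<rfloor> / real_of_int k)) / 2 ^ n) =
    ln 2 / 2 ^ Suc N - 2 * stirling_err 2 (Suc (Suc N)) + stirling_err 2 N / 2 - 2 * ln 2"
proof (induction N)
  case 0
  show ?case
    by (simp add: odd_block_Suc_0 stirling_err_small ln_div field_simps)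
next
  case (Suc N)
  \<comment> \<open>These are the values of \<open>k + 1\<close> for \<open>k = 4 * i + 1\<close>
    and \<open>k = 4 * i + 3\<close>, with the summands in simplified order.\<close>
  have fl: "\<lfloor>(2 + 4 * real i) / 4\<rfloor> = int i" "\<lfloor>(4 + 4 * real i) / 4\<rfloor> = int i + 1" for i
    by (simp_all add: floor_eq_iff field_simps)
  have "(\<Sum>k\<in>odd_block (Suc (Suc N)). ln (4 * real_of_int \<lfloor>(real_of_int k + 1) / 4\<rfloor> / real_of_int k)) =
      (\<Sum>i=2 ^ N..<2 ^ Suc N. ln (4 * real i / (4 * real i + 1)) + ln ((4 * real i + 4) / (4 * real i + 3)))"
    by (simp add: sum_odd_block_mod4 fl)
  also have "\<dots> =
      6 * 2 ^ N * ln 2 + 2 * (ln_fact (2 ^ Suc N) - ln_fact (2 ^ N))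
      + (ln_fact (2 ^ Suc (Suc N)) - ln_fact (2 ^ Suc N))
      - (ln_fact (2 ^ Suc (Suc (Suc N))) - ln_fact (2 ^ Suc (Suc N))) - ln 2"
    using sum_ln_mod4_outer[of "2 ^ N" "2 ^ Suc N"]
    by (simp add: ln_realpow ln_mult algebra_simps)
  finally show ?case
    using Suc by (simp add: ln_fact_power del: power_Suc) (simp add: field_simps)
qed

text \<open>Each block after the first leaves a boundary term \<open>- ln 3 / 3 ^ n\<close>; summing
  this geometric series of ratio 1/3 produces the halves of \<open>ln 3\<close>.\<close>

lemma telescope_4:
  "(\<Sum>n=1..Suc N. (\<Sum>k\<in>nonmult3_block n.
      ln (3 * real_of_int \<lfloor>(real_of_int k + 1) / 3\<rfloor> / real_of_int k)) / 3 ^ n) =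
    ln 3 / (2 * 3 ^ Suc N) - stirling_err 3 (Suc N) + stirling_err 3 N / 3 - ln 3 / 2"
proof (induction N)
  case 0
  show ?case
    by (simp add: nonmult3_block_Suc_0 stirling_err_small ln_div field_simps)
next
  case (Suc N)
  have fl: "\<lfloor>(2 + 3 * real i) / 3\<rfloor> = int i" "\<lfloor>(3 + 3 * real i) / 3\<rfloor> = int i + 1" for i
    by (simp_all add: floor_eq_iff field_simps)
  have "(\<Sum>k\<in>nonmult3_block (Suc (Suc N)). ln (3 * real_of_int \<lfloor>(real_of_int k + 1) / 3\<rfloor> / real_of_int k)) =
      (\<Sum>i=3 ^ N..<3 ^ Suc N. ln (3 * real i / (3 * real i + 1)) + ln ((3 * real i + 3) / (3 * real i + 2)))"
    by (simp add: sum_nonmult3_block fl)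
  also have "\<dots> =
      6 * 3 ^ N * ln 3 + 3 * (ln_fact (3 ^ Suc N) - ln_fact (3 ^ N))
      - (ln_fact (3 ^ Suc (Suc N)) - ln_fact (3 ^ Suc N)) - ln 3"
    using sum_ln_mod3[of "3 ^ N" "3 ^ Suc N"]
    by (simp add: ln_realpow ln_mult algebra_simps)
  finally show ?case
    using Suc by (simp add: ln_fact_power del: power_Suc) (simp add: field_simps)
qed

section \<open>The four limits\<close>

theorem theorem2:
  shows
    "((\<lambda>N. \<Prod>n=1..N. (\<Prod>k\<in>odd_block n. (real_of_int k - 1) / real_of_int k) powr (1 / 2 ^ n))
       \<longlonglongrightarrow> exp 1 / 4) \<and>
     ((\<lambda>N. 2 * (\<Prod>n=1..N. (\<Prod>k\<in>odd_block n.
         (4 * real_of_int \<lfloor>real_of_int k / 4\<rfloor> + 2) / real_of_int k) powr (1 / 2 ^ n)))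
       \<longlonglongrightarrow> sqrt (exp 1)) \<and>
     ((\<lambda>N. 2 * (\<Prod>n=1..N. (\<Prod>k\<in>odd_block n.
         4 * real_of_int \<lfloor>(real_of_int k + 1) / 4\<rfloor> / real_of_int k) powr (1 / 2 ^ n)))
       \<longlonglongrightarrow> exp 1 powr (3 / 2) / 2) \<and>
     ((\<lambda>N. \<Prod>n=1..N. (\<Prod>k\<in>nonmult3_block n.
         3 * real_of_int \<lfloor>(real_of_int k + 1) / 3\<rfloor> / real_of_int k) powr (1 / 3 ^ n))
       \<longlonglongrightarrow> exp 1 powr (2 / 3) / sqrt 3)"
proof (intro conjI, goal_cases)
  note e2 = stirling_err_tendsto[of 2] and e3 = stirling_err_tendsto[of 3]
  note lims = tendsto_intros LIMSEQ_divide_realpow_zero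
  {
    case 1
    \<comment> \<open>Each error tends to -1, so the limit can be read off from the coefficients:
      \<open>2 - 1 - 2 * ln 2\<close>.\<close>
    have "(\<lambda>N. ln 2 / 2 ^ N - 2 * stirling_err 2 (Suc N) + stirling_err 2 N - 2 * ln 2)
        \<longlonglongrightarrow> 0 - 2 * (-1) + (-1) - 2 * ln 2"
      by (intro lims LIMSEQ_Suc e2) auto
    then have "(\<lambda>N. exp (\<Sum>n=1..N. (\<Sum>k\<in>odd_block n.
        ln ((real_of_int k - 1) / real_of_int k)) / 2 ^ n))
        \<longlonglongrightarrow> exp (1 - ln 4)"
      unfolding telescope_1 by (intro tendsto_exp) simp
    then have "(\<lambda>N. exp (\<Sum>n=1..N. (\<Sum>k\<in>odd_block n.
        ln ((real_of_int k - 1) / real_of_int k)) / 2 ^ n))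
        \<longlonglongrightarrow> exp 1 / 4"
      by (simp only: exp_diff exp_ln zero_less_numeral)
    moreover have "(real_of_int k - 1) / real_of_int k > 0" if "n \<ge> 1" "k \<in> odd_block n" for n k
      using odd_block_ge_3[OF that] by simp
    ultimately show ?case
      by (subst prod_powr_eq_exp_sum) auto
  next
    case 2
    have "(\<lambda>N. - 2 * stirling_err 2 (Suc (Suc N)) + 2 * stirling_err 2 (Suc N) - stirling_err 2 N / 2 - ln 2)
        \<longlonglongrightarrow> - 2 * (-1) + 2 * (-1) - (-1) / 2 - ln 2"
      by (intro lims LIMSEQ_Suc e2) auto
    then have "(\<lambda>N. 2 * exp (\<Sum>n=1..Suc N. (\<Sum>k\<in>odd_block n.
        ln ((4 * real_of_int \<lfloor>real_of_int k / 4\<rfloor> + 2) / real_of_int k)) / 2 ^ n))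
        \<longlonglongrightarrow> 2 * exp (1 / 2 - ln 2)"
      unfolding telescope_2 by (intro tendsto_mult tendsto_exp tendsto_const) simp
    \<comment> \<open>The telescoped form speaks of \<open>Suc N\<close> blocks; shifting the index
      does not change the limit.\<close>
    then have "(\<lambda>N. 2 * exp (\<Sum>n=1..N. (\<Sum>k\<in>odd_block n.
        ln ((4 * real_of_int \<lfloor>real_of_int k / 4\<rfloor> + 2) / real_of_int k)) / 2 ^ n))
        \<longlonglongrightarrow> 2 * exp (1 / 2 - ln 2)"
      by (rule LIMSEQ_imp_Suc)
    moreover have "2 * exp (1 / 2 - ln 2) = sqrt (exp 1)"
      by (simp add: exp_diff powr_def flip: powr_half_sqrt)
    moreover have "(4 * real_of_int \<lfloor>real_of_int k / 4\<rfloor> + 2) / real_of_int k > 0"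
      if "n \<ge> 1" "k \<in> odd_block n" for n k
    proof -
      have "\<lfloor>real_of_int k / 4\<rfloor> \<ge> 0"
        using odd_block_ge_3[OF that] by simp
      then have "4 * real_of_int \<lfloor>real_of_int k / 4\<rfloor> + 2 > 0"
        by linarith
      then show ?thesis
        using odd_block_ge_3[OF that] by (intro divide_pos_pos) auto
    qed
    ultimately show ?case
      by (subst prod_powr_eq_exp_sum) auto
  next
    case 3
    have "(\<lambda>N. ln 2 / 2 ^ Suc N - 2 * stirling_err 2 (Suc (Suc N)) + stirling_err 2 N / 2 - 2 * ln 2)
        \<longlonglongrightarrow> 0 - 2 * (-1) + (-1) / 2 - 2 * ln 2"
      by (intro lims LIMSEQ_Suc[of "\<lambda>N. ln 2 / 2 ^ N"] LIMSEQ_Suc e2) auto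
    then have "(\<lambda>N. 2 * exp (\<Sum>n=1..Suc N. (\<Sum>k\<in>odd_block n.
        ln (4 * real_of_int \<lfloor>(real_of_int k + 1) / 4\<rfloor> / real_of_int k)) / 2 ^ n))
        \<longlonglongrightarrow> 2 * exp (3 / 2 - ln 4)"
      unfolding telescope_3 by (intro tendsto_mult tendsto_exp tendsto_const) simp
    then have "(\<lambda>N. 2 * exp (\<Sum>n=1..N. (\<Sum>k\<in>odd_block n.
        ln (4 * real_of_int \<lfloor>(real_of_int k + 1) / 4\<rfloor> / real_of_int k)) / 2 ^ n))
        \<longlonglongrightarrow> 2 * exp (3 / 2 - ln 4)"
      by (rule LIMSEQ_imp_Suc)
    \<comment> \<open>Without \<open>ln_four_sq\<close>, \<open>ln 4\<close> stays intact and
      \<open>exp (ln 4)\<close> evaluates to 4.\<close>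
    also have "2 * exp (3 / 2 - ln 4) = exp 1 powr (3 / 2) / (2::real)"
      by (simp add: exp_diff powr_def del: ln_four_sq)
    finally have "(\<lambda>N. 2 * exp (\<Sum>n=1..N. (\<Sum>k\<in>odd_block n.
        ln (4 * real_of_int \<lfloor>(real_of_int k + 1) / 4\<rfloor> / real_of_int k)) / 2 ^ n))
        \<longlonglongrightarrow> exp 1 powr (3 / 2) / 2" .
    moreover have "4 * real_of_int \<lfloor>(real_of_int k + 1) / 4\<rfloor> / real_of_int k > 0"
      if "n \<ge> 1" "k \<in> odd_block n" for n k
      using odd_block_ge_3[OF that] by (simp add: zero_less_floor)
    ultimately show ?case
      by (subst prod_powr_eq_exp_sum) auto
  next
    case 4
    \<comment> \<open>The first term is regrouped as a constant over a power, the shape of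
      \<open>LIMSEQ_divide_realpow_zero\<close>.\<close>
    have "(\<lambda>N. ln 3 / 2 / 3 ^ Suc N - stirling_err 3 (Suc N) + stirling_err 3 N / 3 - ln 3 / 2)
        \<longlonglongrightarrow> 0 - (-1) + (-1) / 3 - ln 3 / 2"
      by (intro lims LIMSEQ_Suc[of "\<lambda>N. ln 3 / 2 / 3 ^ N"] LIMSEQ_Suc e3) auto
    then have "(\<lambda>N. exp (\<Sum>n=1..Suc N. (\<Sum>k\<in>nonmult3_block n.
        ln (3 * real_of_int \<lfloor>(real_of_int k + 1) / 3\<rfloor> / real_of_int k)) / 3 ^ n))
        \<longlonglongrightarrow> exp (2 / 3 - ln (sqrt 3))"
      unfolding telescope_4 by (intro tendsto_exp) (simp add: ln_sqrt)
    then have "(\<lambda>N. exp (\<Sum>n=1..N. (\<Sum>k\<in>nonmult3_block n.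
        ln (3 * real_of_int \<lfloor>(real_of_int k + 1) / 3\<rfloor> / real_of_int k)) / 3 ^ n))
        \<longlonglongrightarrow> exp (2 / 3 - ln (sqrt 3))"
      by (rule LIMSEQ_imp_Suc)
    moreover have "exp (2 / 3 - ln (sqrt 3)) = exp 1 powr (2 / 3) / sqrt 3"
      by (simp add: exp_diff powr_def)
    moreover have "3 * real_of_int \<lfloor>(real_of_int k + 1) / 3\<rfloor> / real_of_int k > 0"
      if "k \<in> nonmult3_block n" for n k
      using nonmult3_block_ge_2[OF that] by (simp add: zero_less_floor)
    ultimately show ?case
      by (subst prod_powr_eq_exp_sum) auto
  }
qed

end
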